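(* For every $t\in\mathbb{C}\setminus\{0\}$ and every integer $m\ge 0$, $$\left.\frac{\partial^{2}J_{\nu}(t)}{\partial\nu^{2}}\right|_{\nu=m}+(-1)^{m+1}\left.\frac{\partial^{2}J_{\nu}(t)}{\partial\nu^{2}}\right|_{\nu=-m}=2\pi\left.\frac{\partial Y_{\nu}(t)}{\partial\nu}\right|_{\nu=m}+\pi^{2}J_{m}(t).$$
   Context: $J_\nu(t)=\sum_{k=0}^{\infty}\frac{(-1)^k}{k!\,\Gamma(k+\nu+1)}\left(\frac{t}{2}\right)^{2k+\nu}$ is the Bessel function of the first kind (principal branch, $-\pi<\arg t\le\pi$; $1/\Gamma$ is zero at the poles of $\Gamma$), and $Y_\nu(t)=\frac{J_\nu(t)\cos\pi\nu-J_{-\nu}(t)}{\sin\pi\nu}$ (for integer $\nu$, the limit in $\nu$) is the Bessel function of the second kind. *)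

theory Defs
  imports "HOL-Analysis.Analysis"
begin

text \<open>
  The order \<open>\<nu>\<close> is complex. The entire function \<^const>\<open>rGamma\<close> is \<open>1/\<Gamma>\<close> with value 0 at the
  poles of \<open>\<Gamma>\<close>, and complex \<open>powr\<close> is taken with the principal logarithm (imaginary part in
  \<open>]-\<pi>, \<pi>]\<close>). Since \<open>0 powr z = 0\<close> for all \<open>z\<close>, the definition is meaningful only for \<open>t \<noteq> 0\<close>.
\<close>
definition bessel_J :: "complex \<Rightarrow> complex \<Rightarrow> complex" where
  "bessel_J \<nu> t =
     (\<Sum>k. (-1) ^ k / fact k * rGamma (of_nat k + \<nu> + 1) * (t / 2) powr (2 * of_nat k + \<nu>))"

definition bessel_Y_quotient :: "complex \<Rightarrow> complex \<Rightarrow> complex" where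
  "bessel_Y_quotient \<nu> t =
     (bessel_J \<nu> t * cos (of_real pi * \<nu>) - bessel_J (-\<nu>) t) / sin (of_real pi * \<nu>)"

definition bessel_Y :: "complex \<Rightarrow> complex \<Rightarrow> complex" where
  "bessel_Y \<nu> t =
     (if \<nu> \<in> \<int> then Lim (at \<nu>) (\<lambda>\<mu>. bessel_Y_quotient \<mu> t) else bessel_Y_quotient \<nu> t)"

end

theory Submission
  imports Defs "HOL-Complex_Analysis.Cauchy_Integral_Formula"
begin

text \<open>
  For fixed \<open>t \<noteq> 0\<close> the function \<open>J(\<nu>)\<close> is entire in the order. At \<open>\<nu> = m\<close> both
  \<open>g(\<nu>) = J(\<nu>) cos \<pi>\<nu> - J(-\<nu>)\<close> and \<open>sin \<pi>\<nu>\<close> vanish, the latter simply, so \<open>Y\<close> is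
  holomorphic near \<open>m\<close> and satisfies \<open>Y(\<nu>) sin \<pi>\<nu> = g(\<nu>)\<close> there. The claim is the second
  derivative of this equation at \<open>\<nu> = m\<close>, up to the sign \<open>(-1)^m\<close>.
\<close>

text \<open>The recurrence \<open>w * rGamma (w + 1) = rGamma w\<close> shows that a unit shift
  cannot increase the modulus once \<open>norm w\<close> is at least 1. From a suitable index on, a
  bound at that index therefore serves all later ones, uniformly on \<open>K\<close>.\<close>

lemma rGamma_shift_bounded:
  fixes K :: "complex set"
  assumes "compact K"
  obtains N :: nat and C where
    "\<And>k \<nu>. N \<le> k \<Longrightarrow> \<nu> \<in> K \<Longrightarrow> norm (rGamma (of_nat k + \<nu> + 1)) \<le> C"
proof -
  obtain R where R: "\<And>\<nu>. \<nu> \<in> K \<Longrightarrow> norm \<nu> \<le> R"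
    using compact_imp_bounded[OF assms] by (auto simp: bounded_iff)
  \<comment> \<open>For \<open>k\<close> from \<open>N\<close> on,
    \<open>norm (of_nat k + \<nu> + 1)\<close> is at least \<open>k + 1 - R\<close>, hence at least
    1 on all of \<open>K\<close>.\<close>
  define N where "N = nat \<lceil>R + 1\<rceil>"
  have N: "R + 1 \<le> real N" unfolding N_def by linarith
  have "continuous_on K (\<lambda>\<nu>. rGamma (of_nat N + \<nu> + 1))"
    by (intro holomorphic_on_imp_continuous_on holomorphic_intros)
  then have "bounded ((\<lambda>\<nu>. rGamma (of_nat N + \<nu> + 1)) ` K)"
    using assms by (intro compact_imp_bounded compact_continuous_image)
  then obtain C where C: "\<And>\<nu>. \<nu> \<in> K \<Longrightarrow> norm (rGamma (of_nat N + \<nu> + 1)) \<le> C"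
    by (auto simp: bounded_iff)
  have "norm (rGamma (of_nat k + \<nu> + 1)) \<le> C" if "N \<le> k" and nu: "\<nu> \<in> K" for k \<nu>
    using that(1)
  proof (induction k rule: dec_induct)
    case base
    then show ?case using C nu by blast
  next
    case (step k)
    let ?w = "of_nat k + \<nu> + 1 :: complex"
    have "real k + 1 - norm \<nu> \<le> norm ?w"
      using norm_triangle_ineq2[of "of_nat (Suc k) :: complex" "- \<nu>"]
      by (simp add: algebra_simps del: of_nat_Suc) (simp add: algebra_simps)
    then have "1 \<le> norm ?w" using R[OF nu] N step.hyps by linarith
    then have "norm (rGamma (?w + 1)) \<le> norm ?w * norm (rGamma (?w + 1))"
      by (simp add: mult_le_cancel_right1)
    also have "\<dots> = norm (rGamma ?w)"
      by (metis norm_mult rGamma_plus1)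
    also have "\<dots> \<le> C" by (fact step.IH)
    finally show ?case by (simp add: algebra_simps)
  qed
  then show ?thesis using that by blast
qed

definition bessel_J_term :: "complex \<Rightarrow> nat \<Rightarrow> complex \<Rightarrow> complex" where
  "bessel_J_term t k \<nu> =
     (-1) ^ k / fact k * rGamma (of_nat k + \<nu> + 1) * (t / 2) powr (2 * of_nat k + \<nu>)"

text \<open>This supplies the majorant for the M-test: on \<open>K\<close> both the reciprocal Gamma
  factor and \<open>(t / 2) powr \<nu>\<close> are bounded independently of \<open>k\<close>, which
  leaves the terms of an exponential series.\<close>

lemma bessel_J_term_bound:
  fixes K :: "complex set"
  assumes "t \<noteq> 0" "compact K"
  obtains N C where "\<And>k \<nu>. N \<le> k \<Longrightarrow> \<nu> \<in> K \<Longrightarrow>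
    norm (bessel_J_term t k \<nu>) \<le> C * (norm ((t / 2)\<^sup>2) ^ k / fact k)"
proof -
  obtain N C where C: "\<And>k \<nu>. N \<le> k \<Longrightarrow> \<nu> \<in> K \<Longrightarrow> norm (rGamma (of_nat k + \<nu> + 1)) \<le> C"
    by (rule rGamma_shift_bounded[OF assms(2)]) blast
  have "continuous_on K (\<lambda>\<nu>. (t / 2) powr \<nu>)"
    using assms by (intro holomorphic_on_imp_continuous_on holomorphic_intros)
  then have "bounded ((\<lambda>\<nu>. (t / 2) powr \<nu>) ` K)"
    using assms by (intro compact_imp_bounded compact_continuous_image) auto
  then obtain D where D: "\<And>\<nu>. \<nu> \<in> K \<Longrightarrow> norm ((t / 2) powr \<nu>) \<le> D"
    by (auto simp: bounded_iff)
  define z where "z = norm ((t / 2)\<^sup>2)"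
  have "norm (bessel_J_term t k \<nu>) \<le> C * D * (z ^ k / fact k)" if "N \<le> k" "\<nu> \<in> K" for k \<nu>
  proof -
    \<comment> \<open>Both powers use the same logarithm of \<open>t / 2\<close>, so splitting the
      exponent raises no branch problem.\<close>
    have "(t / 2) powr (2 * of_nat k + \<nu>) = ((t / 2)\<^sup>2) ^ k * (t / 2) powr \<nu>"
      using assms powr_nat'[of "t / 2" "2 * k"] by (simp add: powr_add power_mult)
    then have "norm (bessel_J_term t k \<nu>) =
        z ^ k / fact k * (norm (rGamma (of_nat k + \<nu> + 1)) * norm ((t / 2) powr \<nu>))"
      by (simp add: bessel_J_term_def z_def norm_mult norm_divide norm_power)
    also have "\<dots> \<le> z ^ k / fact k * (C * D)"
    proof (rule mult_left_mono)
      show "norm (rGamma (of_nat k + \<nu> + 1)) * norm ((t / 2) powr \<nu>) \<le> C * D"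
        using C[OF that] D[OF that(2)] by (intro mult_mono') auto
    qed (simp add: z_def)
    finally show ?thesis by (simp add: mult_ac)
  qed
  then show ?thesis using that unfolding z_def by blast
qed

lemma summable_exp_bound: "summable (\<lambda>k. C * (x ^ k / fact k) :: real)"
  using summable_exp_generic[of x] by (intro summable_mult) (simp add: field_simps)

lemma bessel_J_sums:
  assumes "t \<noteq> 0"
  shows "(\<lambda>k. bessel_J_term t k \<nu>) sums bessel_J \<nu> t"
proof -
  obtain N C where "\<And>k. N \<le> k \<Longrightarrow>
      norm (bessel_J_term t k \<nu>) \<le> C * (norm ((t / 2)\<^sup>2) ^ k / fact k)"
    by (rule bessel_J_term_bound[OF assms compact_sing[of \<nu>]]) blast
  then have "summable (\<lambda>k. bessel_J_term t k \<nu>)"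
    by (rule summable_comparison_test'[OF summable_exp_bound])
  then show ?thesis
    using summable_sums by (auto simp: bessel_J_def bessel_J_term_def)
qed

lemma bessel_J_holomorphic_order:
  assumes "t \<noteq> 0"
  shows "(\<lambda>\<nu>. bessel_J \<nu> t) holomorphic_on A"
proof -
  have "(\<lambda>\<nu>. bessel_J \<nu> t) holomorphic_on UNIV"
  proof (rule holomorphic_uniform_sequence[where f = "\<lambda>n \<nu>. \<Sum>k<n. bessel_J_term t k \<nu>"])
    show "(\<lambda>\<nu>. \<Sum>k<n. bessel_J_term t k \<nu>) holomorphic_on UNIV" for n
      unfolding bessel_J_term_def using assms by (intro holomorphic_intros) auto
  next
    fix x :: complex
    obtain N C where bound: "\<And>k \<nu>. N \<le> k \<Longrightarrow> \<nu> \<in> cball x 1 \<Longrightarrow>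
        norm (bessel_J_term t k \<nu>) \<le> C * (norm ((t / 2)\<^sup>2) ^ k / fact k)"
      by (rule bessel_J_term_bound[OF assms compact_cball[of x 1]]) blast
    have "uniform_limit (cball x 1) (\<lambda>n \<nu>. \<Sum>k<n. bessel_J_term t k \<nu>)
        (\<lambda>\<nu>. \<Sum>k. bessel_J_term t k \<nu>) sequentially"
      \<comment> \<open>The eventual form of the M-test is used because the majorant is valid only
        from index \<open>N\<close> on.\<close>
      by (rule Weierstrass_m_test_ev[OF _ summable_exp_bound[of C "norm ((t / 2)\<^sup>2)"]])
        (intro eventually_sequentiallyI[of N] ballI bound)
    then show "\<exists>d>0. cball x d \<subseteq> UNIV \<and>
        uniform_limit (cball x d) (\<lambda>n \<nu>. \<Sum>k<n. bessel_J_term t k \<nu>) (\<lambda>\<nu>. bessel_J \<nu> t) sequentially"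
      by (intro exI[of _ 1]) (simp add: bessel_J_term_def bessel_J_def)
  qed simp
  then show ?thesis by (rule holomorphic_on_subset) simp
qed

lemma bessel_J_minus_holomorphic_order:
  assumes "t \<noteq> 0"
  shows "(\<lambda>\<nu>. bessel_J (- \<nu>) t) holomorphic_on A"
  using holomorphic_on_compose[OF holomorphic_on_minus[OF holomorphic_on_ident]
      bessel_J_holomorphic_order[OF assms]]
  by (simp add: o_def)

text \<open>At order \<open>-m\<close> the zeros of \<open>rGamma\<close> kill the first
  \<open>m\<close> terms. What remains is the series of order \<open>m\<close> shifted by
  \<open>m\<close> places, which gives the sign.\<close>

lemma bessel_J_minus_of_nat:
  assumes "t \<noteq> 0"
  shows "bessel_J (- of_nat m) t = (-1) ^ m * bessel_J (of_nat m) t"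
proof -
  let ?a = "\<lambda>k. bessel_J_term t k (- of_nat m)" and ?b = "\<lambda>k. bessel_J_term t k (of_nat m)"
  have zero: "?a k = 0" if "k < m" for k
  proof -
    have eq: "of_nat k + - of_nat m + 1 = - (of_nat (m - k - 1) :: complex)"
      using that by (simp add: of_nat_diff)
    show ?thesis unfolding bessel_J_term_def eq by simp
  qed
  have rG: "rGamma (of_nat n + 1 :: complex) = 1 / fact n" for n
    using Gamma_fact[of n, where ?'a = complex]
    by (simp add: rGamma_inverse_Gamma divide_inverse add.commute)
  \<comment> \<open>The factorial and the reciprocal Gamma factor trade places: both sides contain
    \<open>1 / (fact k * fact (k + m))\<close>.\<close>
  have shift: "?a (k + m) = (-1) ^ m * ?b k" for k
  proof -
    have "2 * of_nat (k + m) + - of_nat m = (2 * of_nat k + of_nat m :: complex)"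
      "of_nat (k + m) + - of_nat m + 1 = (of_nat k + 1 :: complex)"
      by simp_all
    then show ?thesis
      using rG[of k] rG[of "k + m"] by (simp add: bessel_J_term_def power_add mult_ac add_ac)
  qed
  have "(\<lambda>k. ?a (k + m)) sums ((-1) ^ m * bessel_J (of_nat m) t)"
    unfolding shift by (intro sums_mult bessel_J_sums assms)
  then have "?a sums ((-1) ^ m * bessel_J (of_nat m) t)"
    by (subst (asm) sums_zero_iff_shift) (rule zero)
  then show ?thesis using bessel_J_sums[OF assms] sums_unique2 by blast
qed

text \<open>Dividing \<open>g\<close> and \<open>s\<close> by \<open>z - a\<close> leaves removable
  singularities, and the simplicity of the zero of \<open>s\<close> makes the second quotient
  nonzero at \<open>a\<close> too. The conclusion is a product so that it also holds at
  \<open>a\<close>.\<close>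

lemma holomorphic_quotient_simple_zero:
  fixes g s :: "complex \<Rightarrow> complex"
  assumes "g holomorphic_on S" "s holomorphic_on S" "open S"
    and "g a = 0" "s a = 0" "deriv s a \<noteq> 0" "\<And>z. z \<in> S - {a} \<Longrightarrow> s z \<noteq> 0"
  obtains h where "h holomorphic_on S" "\<And>z. z \<in> S \<Longrightarrow> h z * s z = g z"
proof -
  define G where "G z = (if z = a then deriv g a else g z / (z - a))" for z
  define H where "H z = (if z = a then deriv s a else s z / (z - a))" for z
  have "G holomorphic_on S"
    by (rule pole_theorem_open_0[OF assms(1,3), of a]) (simp_all add: G_def assms(4))
  moreover have "H holomorphic_on S"
    by (rule pole_theorem_open_0[OF assms(2,3), of a]) (simp_all add: H_def assms(5))
  moreover have "H z \<noteq> 0" if "z \<in> S" for z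
    using assms(6) assms(7)[of z] that by (simp add: H_def)
  ultimately have "(\<lambda>z. G z / H z) holomorphic_on S"
    by (intro holomorphic_intros)
  moreover have "G z / H z * s z = g z" if "z \<in> S" for z
    using assms(4,5) assms(7)[of z] that by (simp add: G_def H_def)
  ultimately show ?thesis by (rule that)
qed

lemma sin_of_real_pi_mult_eq_0_iff:
  "sin (of_real pi * z :: complex) = 0 \<longleftrightarrow> z \<in> \<int>"
  by (auto simp: sin_eq_0 Ints_def mult.commute)

lemma sin_cos_of_real_pi_of_nat:
  "sin (of_real pi * of_nat m :: complex) = 0" "cos (of_real pi * of_nat m :: complex) = (-1) ^ m"
proof -
  show "sin (of_real pi * of_nat m :: complex) = 0"
    by (simp add: sin_of_real_pi_mult_eq_0_iff)
  have "cos (of_real pi * of_nat m :: complex) = of_real (cos (pi * real m))"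
    by (metis cos_of_real of_real_mult of_real_of_nat_eq)
  then show "cos (of_real pi * of_nat m :: complex) = (-1) ^ m"
    by (simp add: mult.commute)
qed

text \<open>The open ball of radius 1 contains no integer but its centre, so the sine has a single
  zero there. It is simple, and the numerator vanishes at it by the reflection formula for integer
  orders.\<close>

lemma bessel_Y_holomorphic_near_of_nat:
  assumes "t \<noteq> 0"
  shows "(\<lambda>\<nu>. bessel_Y \<nu> t) holomorphic_on ball (of_nat m) 1"
    and "\<nu> \<in> ball (of_nat m) 1 \<Longrightarrow> bessel_Y \<nu> t * sin (of_real pi * \<nu>) =
      bessel_J \<nu> t * cos (of_real pi * \<nu>) - bessel_J (- \<nu>) t"
proof -
  let ?B = "ball (of_nat m) 1 :: complex set"
  let ?g = "\<lambda>\<nu>. bessel_J \<nu> t * cos (of_real pi * \<nu>) - bessel_J (- \<nu>) t"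
  let ?s = "\<lambda>\<nu>. sin (of_real pi * \<nu> :: complex)"
  have notint: "\<nu> \<notin> \<int>" if "\<nu> \<in> ?B - {of_nat m}" for \<nu>
  proof
    assume "\<nu> \<in> \<int>"
    then obtain n where n: "\<nu> = of_int n" by (auto elim: Ints_cases)
    have "dist (of_nat m) \<nu> = \<bar>real_of_int (int m - n)\<bar>"
      by (metis n dist_norm norm_of_int of_int_diff of_int_of_nat_eq)
    then have "int m = n" using that n by simp linarith
    then show False using that n by auto
  qed
  have "(?s has_field_derivative cos (of_real pi * of_nat m) * of_real pi) (at (of_nat m))"
    by (auto intro!: derivative_eq_intros)
  then have "deriv ?s (of_nat m) \<noteq> 0"
    by (simp add: DERIV_imp_deriv sin_cos_of_real_pi_of_nat)
  moreover have "?g holomorphic_on ?B"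
    by (intro holomorphic_intros bessel_J_minus_holomorphic_order bessel_J_holomorphic_order assms)
  moreover have "?s holomorphic_on ?B" by (intro holomorphic_intros)
  moreover have "?g (of_nat m) = 0" "?s (of_nat m) = 0"
    using bessel_J_minus_of_nat[OF assms] by (simp_all add: sin_cos_of_real_pi_of_nat)
  moreover have "?s \<nu> \<noteq> 0" if "\<nu> \<in> ?B - {of_nat m}" for \<nu>
    using notint[OF that] by (simp add: sin_of_real_pi_mult_eq_0_iff)
  ultimately obtain h where h: "h holomorphic_on ?B" "\<And>\<nu>. \<nu> \<in> ?B \<Longrightarrow> h \<nu> * ?s \<nu> = ?g \<nu>"
    using holomorphic_quotient_simple_zero[of ?g ?B ?s "of_nat m", OF _ _ open_ball] by blast
  have quot: "bessel_Y_quotient \<nu> t = h \<nu>" if "\<nu> \<in> ?B - {of_nat m}" for \<nu>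
    using h(2)[of \<nu>] that notint[OF that]
    by (simp add: bessel_Y_quotient_def sin_of_real_pi_mult_eq_0_iff divide_eq_eq)
  \<comment> \<open>At the centre \<open>bessel_Y\<close> is defined by \<open>Lim\<close>;
    continuity of \<open>h\<close> identifies that limit with \<open>h (of_nat m)\<close>.\<close>
  have "isCont h (of_nat m)"
    using continuous_on_interior[OF holomorphic_on_imp_continuous_on[OF h(1)]] by simp
  then have "((\<lambda>\<mu>. bessel_Y_quotient \<mu> t) \<longlongrightarrow> h (of_nat m)) (at (of_nat m))"
    unfolding isCont_def
    by (rule Lim_transform_within_open[where s = ?B]) (auto simp: quot)
  then have "Lim (at (of_nat m)) (\<lambda>\<mu>. bessel_Y_quotient \<mu> t) = h (of_nat m)"
    by (intro tendsto_Lim) auto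
  then have Y: "bessel_Y \<nu> t = h \<nu>" if "\<nu> \<in> ?B" for \<nu>
    using that quot[of \<nu>] notint[of \<nu>] by (cases "\<nu> = of_nat m") (auto simp: bessel_Y_def)
  then show "(\<lambda>\<nu>. bessel_Y \<nu> t) holomorphic_on ?B"
    by (intro holomorphic_transform[OF h(1)]) simp
  show "\<nu> \<in> ?B \<Longrightarrow> bessel_Y \<nu> t * ?s \<nu> = ?g \<nu>"
    using h(2) Y by simp
qed

lemma second_deriv_mult:
  fixes f g :: "complex \<Rightarrow> complex"
  assumes "f holomorphic_on S" "g holomorphic_on S" "open S" "z \<in> S"
  shows "(deriv ^^ 2) (\<lambda>w. f w * g w) z =
    (deriv ^^ 2) f z * g z + 2 * deriv f z * deriv g z + f z * (deriv ^^ 2) g z"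
  using higher_deriv_mult[OF assms, of 2] by (simp add: numeral_2_eq_2 algebra_simps)

theorem theorem3p3:
  fixes t :: complex and m :: nat
  assumes "t \<noteq> 0"
  shows "(\<lambda>\<nu>. bessel_J \<nu> t) analytic_on {of_nat m, - of_nat m}
    \<and> (\<lambda>\<nu>. bessel_Y \<nu> t) field_differentiable at (of_nat m)
    \<and> (deriv ^^ 2) (\<lambda>\<nu>. bessel_J \<nu> t) (of_nat m)
           + (-1) ^ (m + 1) * (deriv ^^ 2) (\<lambda>\<nu>. bessel_J \<nu> t) (- of_nat m)
         = 2 * of_real pi * deriv (\<lambda>\<nu>. bessel_Y \<nu> t) (of_nat m)
           + (of_real pi)\<^sup>2 * bessel_J (of_nat m) t"
proof (intro conjI)
  let ?B = "ball (of_nat m) 1 :: complex set"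
  let ?J = "\<lambda>\<nu>. bessel_J \<nu> t" and ?Y = "\<lambda>\<nu>. bessel_Y \<nu> t"
  let ?s = "\<lambda>\<nu>. sin (of_real pi * \<nu> :: complex)" and ?c = "\<lambda>\<nu>. cos (of_real pi * \<nu> :: complex)"
  let ?m = "of_nat m :: complex"
  note J = bessel_J_holomorphic_order[OF assms] and Jm = bessel_J_minus_holomorphic_order[OF assms]
  note Y = bessel_Y_holomorphic_near_of_nat[OF assms, where m = m]
  \<comment> \<open>Since \<open>deriv\<close> is a total operator, the first two conjuncts certify
    that the derivatives in the identity are genuine.\<close>
  show "?J analytic_on {of_nat m, - of_nat m}"
    using analytic_on_holomorphic J by blast
  show "?Y field_differentiable at ?m"
    using Y(1) by (simp add: holomorphic_on_imp_differentiable_at)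
  have s: "?s holomorphic_on ?B" and c: "?c holomorphic_on ?B"
    by (intro holomorphic_intros)+
  have ds: "deriv ?s = (\<lambda>\<nu>. of_real pi * ?c \<nu>)"
    by (intro ext DERIV_imp_deriv) (auto intro!: derivative_eq_intros)
  have dc: "deriv ?c = (\<lambda>\<nu>. - of_real pi * ?s \<nu>)"
    by (intro ext DERIV_imp_deriv) (auto intro!: derivative_eq_intros)
  have d2s: "(deriv ^^ 2) ?s ?m = 0"
    unfolding numeral_2_eq_2 funpow.simps o_def id_def ds
    by (rule DERIV_imp_deriv) (auto intro!: derivative_eq_intros simp: sin_cos_of_real_pi_of_nat)
  have d2c: "(deriv ^^ 2) ?c ?m = - (of_real pi)\<^sup>2 * (-1) ^ m"
    unfolding numeral_2_eq_2 funpow.simps o_def id_def dc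
    by (rule DERIV_imp_deriv)
      (auto intro!: derivative_eq_intros simp: sin_cos_of_real_pi_of_nat power2_eq_square)
  \<comment> \<open>Both \<open>?s\<close> and its second derivative vanish at \<open>?m\<close>, so
    only the mixed term of the Leibniz rule survives and the second derivative of \<open>?Y\<close>
    drops out.\<close>
  have "2 * deriv ?Y ?m * (of_real pi * (-1) ^ m) = (deriv ^^ 2) (\<lambda>\<nu>. ?Y \<nu> * ?s \<nu>) ?m"
    using Y(1) s by (subst second_deriv_mult[where S = ?B])
      (auto simp: ds d2s sin_cos_of_real_pi_of_nat)
  also have "\<dots> = (deriv ^^ 2) (\<lambda>\<nu>. ?J \<nu> * ?c \<nu> - bessel_J (- \<nu>) t) ?m"
    using Y by (intro higher_deriv_transform_within_open[where S = ?B])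
      (auto intro!: holomorphic_intros J Jm)
  also have "\<dots> = (deriv ^^ 2) (\<lambda>\<nu>. ?J \<nu> * ?c \<nu>) ?m - (deriv ^^ 2) (\<lambda>\<nu>. bessel_J (- \<nu>) t) ?m"
    by (intro higher_deriv_diff[where S = ?B] holomorphic_intros J Jm) auto
  \<comment> \<open>Two differentiations of the reflected function bring out the factor
    \<open>(-1)\<^sup>2 = 1\<close>.\<close>
  also have "(deriv ^^ 2) (\<lambda>\<nu>. bessel_J (- \<nu>) t) ?m = (deriv ^^ 2) ?J (- ?m)"
    using higher_deriv_compose_linear[OF J open_UNIV open_UNIV, of ?m "-1" 2] by simp
  \<comment> \<open>Here the mixed term vanishes, because \<open>deriv ?c\<close> is a multiple of
    the sine; the second derivative of the cosine produces the \<open>\<pi>\<^sup>2\<close>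
    term.\<close>
  also have "(deriv ^^ 2) (\<lambda>\<nu>. ?J \<nu> * ?c \<nu>) ?m =
      (deriv ^^ 2) ?J ?m * (-1) ^ m - (of_real pi)\<^sup>2 * (-1) ^ m * ?J ?m"
    using J c by (subst second_deriv_mult[where S = ?B])
      (auto simp: dc d2c sin_cos_of_real_pi_of_nat)
  finally show "(deriv ^^ 2) ?J ?m + (-1) ^ (m + 1) * (deriv ^^ 2) ?J (- ?m)
      = 2 * of_real pi * deriv ?Y ?m + (of_real pi)\<^sup>2 * ?J ?m"
    \<comment> \<open>The chain proves the claim multiplied by \<open>(-1) ^ m\<close>; fixing the
      parity of \<open>m\<close> removes that factor.\<close>
    by (cases "even m") (simp_all add: algebra_simps)
qed

end
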